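(* Let $\Omega\subset\mathbb{R}^2$ be a bounded region whose boundary $\partial\Omega$ is the union of a finite number of disjoint simple Lipschitz loops, and let $p\in[1,\infty)$. If $\mathbf{v}\in L^p(\Omega;\mathbb{R}^2)$ is a harmonic vector field, then it is $C^\infty$ on $\Omega$.
   Context: A region is a non-empty connected open subset of $\mathbb{R}^2$. A simple Lipschitz loop is a closed, non-self-intersecting curve with at least two distinct points and a uniformly Lipschitz parametrization. $\nabla\varphi=(D_1\varphi,D_2\varphi)$, $\nabla^\perp\varphi=(D_2\varphi,-D_1\varphi)$. A field $\mathbf{v}\in L^1_{loc}(\Omega;\mathbb{R}^2)$ is harmonic if it is both irrotational, i.e. $\int_\Omega\nabla^\perp\varphi\cdot\mathbf{v}\,d^2x=0$ for all $\varphi\in C^1_c(\Omega)$, and solenoidal, i.e. $\int_\Omega\nabla\varphi\cdot\mathbf{v}\,d^2x=0$ for all $\varphi\in C^1_c(\Omega)$. Equality of fields is a.e. *)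

theory Defs
  imports "HOL-Analysis.Analysis"
begin

definition region :: "(real^2) set \<Rightarrow> bool" where
  "region \<Omega> \<longleftrightarrow> \<Omega> \<noteq> {} \<and> connected \<Omega> \<and> open \<Omega>"

text \<open>
  Loops are treated as point sets. Since \<^const>\<open>simple_path\<close> requires injectivity on
  \<open>[0,1)\<close>, such a loop automatically has more than one point.
\<close>

definition simple_Lipschitz_loop :: "(real^2) set \<Rightarrow> bool" where
  "simple_Lipschitz_loop \<Gamma> \<longleftrightarrow>
     (\<exists>\<gamma> L. simple_path \<gamma> \<and> pathfinish \<gamma> = pathstart \<gamma> \<and>
            L-lipschitz_on {0..1} \<gamma> \<and> \<Gamma> = path_image \<gamma>)"

definition Lipschitz_loop_boundary :: "(real^2) set \<Rightarrow> bool" where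
  "Lipschitz_loop_boundary \<Omega> \<longleftrightarrow>
     (\<exists>\<C>. finite \<C> \<and> pairwise disjnt \<C> \<and>
          (\<forall>\<Gamma>\<in>\<C>. simple_Lipschitz_loop \<Gamma>) \<and> frontier \<Omega> = \<Union>\<C>)"

definition partial_deriv ::
  "2 \<Rightarrow> (real^2 \<Rightarrow> 'b::real_normed_vector) \<Rightarrow> real^2 \<Rightarrow> 'b" where
  "partial_deriv j f x = frechet_derivative f (at x) (axis j 1)"

text \<open>
  The following two notions are meant for open sets; they do not depend on the values of
  the function outside the set.
\<close>

primrec Ck_on :: "nat \<Rightarrow> (real^2) set \<Rightarrow> (real^2 \<Rightarrow> 'b::real_normed_vector) \<Rightarrow> bool" where
  "Ck_on 0 S f \<longleftrightarrow> continuous_on S f"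
| "Ck_on (Suc k) S f \<longleftrightarrow>
     (\<forall>x\<in>S. f differentiable (at x)) \<and> (\<forall>j. Ck_on k S (partial_deriv j f))"

definition smooth_on :: "(real^2) set \<Rightarrow> (real^2 \<Rightarrow> 'b::real_normed_vector) \<Rightarrow> bool" where
  "smooth_on S f \<longleftrightarrow> (\<forall>k. Ck_on k S f)"

definition grad :: "(real^2 \<Rightarrow> real) \<Rightarrow> real^2 \<Rightarrow> real^2" where
  "grad \<phi> x = vector [partial_deriv 1 \<phi> x, partial_deriv 2 \<phi> x]"

definition perp_grad :: "(real^2 \<Rightarrow> real) \<Rightarrow> real^2 \<Rightarrow> real^2" where
  "perp_grad \<phi> x = vector [partial_deriv 2 \<phi> x, - partial_deriv 1 \<phi> x]"

definition C1_compact_support :: "(real^2) set \<Rightarrow> (real^2 \<Rightarrow> real) set" where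
  "C1_compact_support \<Omega> =
     {\<phi>. Ck_on 1 \<Omega> \<phi> \<and>
         compact (closure {x\<in>\<Omega>. \<phi> x \<noteq> 0}) \<and> closure {x\<in>\<Omega>. \<phi> x \<noteq> 0} \<subseteq> \<Omega>}"

text \<open>
  Membership in the Lebesgue spaces is stated for representatives; equality almost
  everywhere is made explicit where it is used.
\<close>

definition Lp_field :: "real \<Rightarrow> (real^2) set \<Rightarrow> (real^2 \<Rightarrow> real^2) set" where
  "Lp_field p \<Omega> =
     {v. v \<in> borel_measurable (lebesgue_on \<Omega>) \<and>
         integrable (lebesgue_on \<Omega>) (\<lambda>x. norm (v x) powr p)}"

definition L1_loc_field :: "(real^2) set \<Rightarrow> (real^2 \<Rightarrow> real^2) set" where
  "L1_loc_field \<Omega> =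
     {v. v \<in> borel_measurable (lebesgue_on \<Omega>) \<and>
         (\<forall>K. compact K \<and> K \<subseteq> \<Omega> \<longrightarrow> integrable (lebesgue_on K) v)}"

definition irrotational :: "(real^2) set \<Rightarrow> (real^2 \<Rightarrow> real^2) \<Rightarrow> bool" where
  "irrotational \<Omega> v \<longleftrightarrow>
     (\<forall>\<phi>\<in>C1_compact_support \<Omega>. (LINT x|lebesgue_on \<Omega>. perp_grad \<phi> x \<bullet> v x) = 0)"

definition solenoidal :: "(real^2) set \<Rightarrow> (real^2 \<Rightarrow> real^2) \<Rightarrow> bool" where
  "solenoidal \<Omega> v \<longleftrightarrow>
     (\<forall>\<phi>\<in>C1_compact_support \<Omega>. (LINT x|lebesgue_on \<Omega>. grad \<phi> x \<bullet> v x) = 0)"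

text \<open>
  Local integrability is part of the definition; it makes the integrands above integrable,
  so that the Bochner integrals never take their default value.
\<close>

definition harmonic_field :: "(real^2) set \<Rightarrow> (real^2 \<Rightarrow> real^2) \<Rightarrow> bool" where
  "harmonic_field \<Omega> v \<longleftrightarrow> v \<in> L1_loc_field \<Omega> \<and> irrotational \<Omega> v \<and> solenoidal \<Omega> v"

end

theory Submission
  imports Defs "HOL-Complex_Analysis.Cauchy_Integral_Formula"
begin

text \<open>
  Identify \<open>x\<close> in the plane with the complex number \<open>x\<^sub>1 + \<i> x\<^sub>2\<close> and put \<open>f = v\<^sub>1 - \<i> v\<^sub>2\<close>.
  Testing irrotationality and solenoidality with the real and imaginary parts of a complex
  test function \<open>\<phi>\<close> says exactly that \<open>\<integral> f (D\<^sub>1 \<phi> + \<i> D\<^sub>2 \<phi>) = 0\<close>, the weak form of the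
  Cauchy--Riemann equations (\<open>harmonic_field_weakly_dbar_closed\<close>). So the statement is Weyl's lemma
  for the operator \<open>D\<^sub>1 + \<i> D\<^sub>2\<close>.

  Weyl's lemma follows from one choice of test function. Let
  \<open>\<chi>\<^sub>a\<^sub>,\<^sub>r\<close> be a radial \<open>C\<^sup>1\<close> cutoff which is \<open>1\<close> on the disc of radius \<open>r\<close> about \<open>a\<close> and
  \<open>0\<close> off the disc of radius \<open>2 r\<close>, and insert \<open>\<phi> y = (\<chi>\<^sub>a\<^sub>,\<^sub>r y - \<chi>\<^sub>x\<^sub>,\<^sub>e y) / (y - x)\<close>, where the
  \<open>e\<close>-disc about \<open>x\<close> lies well inside the \<open>r\<close>-disc about \<open>a\<close>. The numerator vanishes near \<open>x\<close>, and
  \<open>1 / (y - x)\<close> is holomorphic elsewhere, so only derivatives of the cutoffs survive. As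
  \<open>(D\<^sub>1 + \<i> D\<^sub>2) \<bar>y\<bar>\<^sup>2 = 2 y\<close>, the one at \<open>x\<close> cancels the denominator and leaves a mean of \<open>f\<close>
  over a small annulus about \<open>x\<close>; the one at \<open>a\<close> leaves a Cauchy integral over an annulus
  about \<open>a\<close> (\<open>annular_mean_eq_cauchy_integral\<close>).

  The Cauchy integral is holomorphic in \<open>x\<close> (\<open>cauchy_integral_holomorphic\<close>) and does not depend
  on \<open>e\<close>. The annular means are convolutions with an approximate identity, so by Fubini and
  dominated convergence their integrals over boxes tend to those of \<open>f\<close>. Therefore \<open>f\<close> agrees almost
  everywhere with a holomorphic function near each point (\<open>weyl_dbar_local\<close>). The local holomorphic
  representatives agree on overlaps by continuity, and a holomorphic function has continuous
  partial derivatives of every order because its complex derivative is again holomorphic.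
\<close>

section \<open>The plane as the complex numbers\<close>

definition cplx :: "real^2 \<Rightarrow> complex" where
  "cplx x = Complex (x$1) (x$2)"

lemma cplx_simps [simp]:
  "Re (cplx x) = x$1" "Im (cplx x) = x$2"
  by (simp_all add: cplx_def)

lemma linear_cplx: "linear cplx"
  by (rule linearI) (simp_all add: complex_eq_iff)

lemma norm_cplx [simp]: "norm (cplx x) = norm x"
  by (simp add: cmod_def norm_vec_def L2_set_def UNIV_2)

lemma cplx_diff: "cplx (x - y) = cplx x - cplx y"
  by (simp add: complex_eq_iff)

lemma cplx_eq_iff [simp]: "cplx x = cplx y \<longleftrightarrow> x = y"
  by (simp add: complex_eq_iff vec_eq_iff forall_2)

lemma cplx_eq_0_iff [simp]: "cplx x = 0 \<longleftrightarrow> x = 0"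
  by (metis norm_cplx norm_eq_zero)

lemma dist_cplx [simp]: "dist (cplx x) (cplx y) = dist x y"
  by (simp add: dist_norm flip: cplx_diff)

definition uncplx :: "complex \<Rightarrow> real^2" where
  "uncplx z = vector [Re z, Im z]"

lemma cplx_uncplx [simp]: "cplx (uncplx z) = z" and uncplx_cplx [simp]: "uncplx (cplx x) = x"
  by (simp_all add: complex_eq_iff uncplx_def vec_eq_iff forall_2)

lemma bounded_linear_uncplx: "bounded_linear uncplx"
  by (auto intro!: linear_conv_bounded_linear[THEN iffD1] linearI
      simp: uncplx_def vec_eq_iff forall_2)

lemma bounded_linear_cplx: "bounded_linear cplx"
  using linear_cplx by (rule linear_conv_bounded_linear[THEN iffD1])

lemmas cplx_has_derivative [derivative_intros] =
  bounded_linear.has_derivative [OF bounded_linear_cplx]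

lemmas cplx_continuous_on [continuous_intros] =
  bounded_linear.continuous_on [OF bounded_linear_cplx]

lemma cplx_measurable [measurable]: "cplx \<in> borel_measurable borel"
  by (intro borel_measurable_continuous_onI cplx_continuous_on continuous_on_id)

section \<open>Radial cutoffs of class C1\<close>

text \<open>
  Squaring the positive part is the simplest \<open>C\<^sup>1\<close> function that is constant on a half-line.
  Composing two copies of it yields a \<open>C\<^sup>1\<close> cutoff, which is all that the test
  functions need, without any case distinction in its derivative.
\<close>

definition pos_sq :: "real \<Rightarrow> real" where
  "pos_sq t = (max 0 t)\<^sup>2"

definition cutoff :: "real \<Rightarrow> real" where
  "cutoff t = pos_sq (1 - pos_sq (t - 1))"

text \<open>
  Minus the derivative of \<^const>\<open>cutoff\<close>.
\<close>

definition bump :: "real \<Rightarrow> real" where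
  "bump t = 4 * max 0 (1 - pos_sq (t - 1)) * max 0 (t - 1)"

lemma pos_sq_deriv [derivative_intros]:
  assumes "(f has_real_derivative f') (at x)"
  shows "((\<lambda>x. pos_sq (f x)) has_real_derivative 2 * max 0 (f x) * f') (at x)"
proof -
  have "(pos_sq has_real_derivative 2 * max 0 t) (at t)" for t
  proof (cases t "0::real" rule: linorder_cases)
    case less
    have "((\<lambda>_. 0) has_real_derivative 0) (at t)" by simp
    then show ?thesis
      by (rule has_field_derivative_transform_within_open[of _ _ _ "{..<0}", THEN DERIV_cong])
        (use less in \<open>auto simp: pos_sq_def\<close>)
  next
    case greater
    have "((\<lambda>t. t\<^sup>2) has_real_derivative 2 * t) (at t)"
      by (auto intro!: derivative_eq_intros)
    then show ?thesis
      by (rule has_field_derivative_transform_within_open[of _ _ _ "{0<..}", THEN DERIV_cong])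
        (use greater in \<open>auto simp: pos_sq_def\<close>)
  next
    case equal
    have "((\<lambda>y. pos_sq y / y) \<longlongrightarrow> 0) (at 0)"
    proof (rule Lim_null_comparison)
      show "\<forall>\<^sub>F y in at 0. norm (pos_sq y / y) \<le> \<bar>y\<bar>"
        by (rule always_eventually) (auto simp: pos_sq_def max_def power2_eq_square)
      show "((\<lambda>y::real. \<bar>y\<bar>) \<longlongrightarrow> 0) (at 0)"
        by (auto intro!: tendsto_eq_intros)
    qed
    then show ?thesis
      using equal by (simp add: has_field_derivative_iff pos_sq_def)
  qed
  from DERIV_chain2[OF this assms] show ?thesis .
qed

lemma cutoff_deriv: "(cutoff has_real_derivative - bump t) (at t)"
  unfolding cutoff_def [abs_def] bump_def
  by (auto intro!: derivative_eq_intros)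

lemma pos_sq_pred_ge_1: "2 \<le> t \<Longrightarrow> 1 \<le> pos_sq (t - 1)"
  unfolding pos_sq_def by (rule one_le_power) simp

lemma pos_sq_eq_0: "t \<le> 0 \<Longrightarrow> pos_sq t = 0"
  by (simp add: pos_sq_def)

lemma cutoff_eq_1: "t \<le> 1 \<Longrightarrow> cutoff t = 1"
  by (simp add: cutoff_def pos_sq_def)

lemma cutoff_eq_0: "2 \<le> t \<Longrightarrow> cutoff t = 0"
  using pos_sq_pred_ge_1[of t] by (simp add: cutoff_def pos_sq_eq_0)

lemma bump_nonneg: "0 \<le> bump t"
  by (simp add: bump_def)

lemma bump_eq_0: "t \<le> 1 \<or> 2 \<le> t \<Longrightarrow> bump t = 0"
  using pos_sq_pred_ge_1[of t] by (auto simp: bump_def)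

lemma bump_le: "bump t \<le> 4"
proof (cases "t \<le> 1 \<or> 2 \<le> t")
  case True then show ?thesis by (simp add: bump_eq_0)
next
  case False
  have "max 0 (1 - pos_sq (t - 1)) * max 0 (t - 1) \<le> 1 * 1"
    using False by (intro mult_mono) (auto simp: pos_sq_def)
  then show ?thesis by (simp add: bump_def)
qed

lemma bump_continuous: "continuous_on UNIV bump"
  unfolding bump_def[abs_def] pos_sq_def by (intro continuous_intros)

text \<open>
  A nonnegative kernel supported in the annulus \<open>r \<le> \<bar>w\<bar> \<le> 2 r\<close>. The factor \<open>1 / r\<^sup>2\<close> serves two
  purposes: it comes out of the chain rule for the radial cutoff of radius \<open>r\<close>, and it makes the mass of
  the kernel independent of \<open>r\<close>, because the plane has dimension two.
\<close>

definition annular_bump :: "real \<Rightarrow> real^2 \<Rightarrow> real" where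
  "annular_bump r w = bump ((norm w / r)\<^sup>2) / r\<^sup>2"

lemma annular_bump_nonneg: "0 \<le> annular_bump r w"
  by (simp add: annular_bump_def bump_nonneg)

lemma annular_bump_le: "annular_bump r w \<le> 4 / r\<^sup>2"
  by (simp add: annular_bump_def bump_le divide_right_mono)

lemma annular_bump_eq_0:
  assumes "0 < r" "norm w \<le> r \<or> 2 * r \<le> norm w"
  shows "annular_bump r w = 0"
proof -
  have "(norm w / r)\<^sup>2 \<le> 1 \<or> 2 \<le> (norm w / r)\<^sup>2"
  proof (cases "norm w \<le> r")
    case True
    then show ?thesis using assms(1) by (auto intro: power_le_one)
  next
    case False
    then have "2 \<le> norm w / r" using assms by (simp add: field_simps)
    then have "2\<^sup>2 \<le> (norm w / r)\<^sup>2" by (rule power_mono) simp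
    then show ?thesis by simp
  qed
  then show ?thesis by (simp add: annular_bump_def bump_eq_0)
qed

lemma annular_bump_continuous: "continuous_on UNIV (annular_bump r)"
  unfolding annular_bump_def[abs_def] divide_inverse
  by (intro continuous_intros continuous_on_compose2[OF bump_continuous]) auto

lemma annular_bump_measurable [measurable]: "annular_bump r \<in> borel_measurable borel"
  by (intro borel_measurable_continuous_onI annular_bump_continuous)

definition radial_cutoff :: "real \<Rightarrow> real^2 \<Rightarrow> real" where
  "radial_cutoff r w = cutoff ((norm w / r)\<^sup>2)"

lemma radial_cutoff_eq_1: "0 < r \<Longrightarrow> norm w \<le> r \<Longrightarrow> radial_cutoff r w = 1"
  by (simp add: radial_cutoff_def cutoff_eq_1 power_le_one)

lemma radial_cutoff_eq_0:
  assumes "0 < r" "2 * r \<le> norm w"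
  shows "radial_cutoff r w = 0"
proof -
  have "2 \<le> norm w / r" using assms by (simp add: field_simps)
  then have "2\<^sup>2 \<le> (norm w / r)\<^sup>2" by (rule power_mono) simp
  then show ?thesis by (simp add: radial_cutoff_def cutoff_eq_0)
qed

lemma radial_cutoff_has_derivative:
  "((\<lambda>y. radial_cutoff r (y - a)) has_derivative
     (\<lambda>h. - 2 * annular_bump r (y - a) * ((y - a) \<bullet> h))) (at y)"
proof -
  have sq: "((\<lambda>y. (norm (y - a) / r)\<^sup>2) has_derivative (\<lambda>h. 2 * ((y - a) \<bullet> h) / r\<^sup>2)) (at y)"
    unfolding power_divide power2_norm_eq_inner unfolding divide_inverse
    by (auto intro!: derivative_eq_intros simp: inner_commute algebra_simps)
  have "((\<lambda>y. cutoff ((norm (y - a) / r)\<^sup>2)) has_derivative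
      (\<lambda>h. (2 * ((y - a) \<bullet> h) / r\<^sup>2) * - bump ((norm (y - a) / r)\<^sup>2))) (at y)"
    using has_derivative_compose[OF sq cutoff_deriv[unfolded has_field_derivative_def]]
    by (simp add: mult.commute)
  then show ?thesis
    unfolding radial_cutoff_def
    by (rule has_derivative_eq_rhs) (simp add: annular_bump_def fun_eq_iff field_simps)
qed

section \<open>The Cauchy integral representation\<close>

lemma integrable_mult_bounded:
  fixes F h :: "real^2 \<Rightarrow> 'b::{banach, second_countable_topology, real_normed_div_algebra}"
  assumes F: "integrable lborel F" and h: "h \<in> borel_measurable borel"
    and bd: "\<And>y. norm (h y) \<le> B"
  shows "integrable lborel (\<lambda>y. F y * h y)"
proof (rule Bochner_Integration.integrable_bound)
  show "integrable lborel (\<lambda>y. B * norm (F y))" using F by simp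
  have B: "0 \<le> B" using bd[of undefined] norm_ge_zero order_trans by blast
  show "AE y in lborel. norm (F y * h y) \<le> norm (B * norm (F y))"
    using mult_mono[OF order_refl bd norm_ge_zero norm_ge_zero] B
    by (intro always_eventually allI) (simp add: norm_mult abs_mult mult.commute mult_left_mono bd)
  show "(\<lambda>y. F y * h y) \<in> borel_measurable lborel"
    using h borel_measurable_integrable[OF F] by simp
qed

text \<open>
  Vanishing of \<open>(D\<^sub>1 + \<i> D\<^sub>2) F\<close> in the sense of distributions, tested with complex \<open>C\<^sup>1\<close> functions
  supported in \<open>K\<close>. The test functions live on the whole plane and their partial derivatives
  \<open>p\<close> and \<open>q\<close> are carried along explicitly.
\<close>

definition weakly_dbar_closed :: "(real^2) set \<Rightarrow> (real^2 \<Rightarrow> complex) \<Rightarrow> bool" where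
  "weakly_dbar_closed K F \<longleftrightarrow>
     (\<forall>\<phi> p q. (\<forall>y. (\<phi> has_derivative (\<lambda>h. h$1 *\<^sub>R p y + h$2 *\<^sub>R q y)) (at y)) \<longrightarrow>
        continuous_on UNIV p \<longrightarrow> continuous_on UNIV q \<longrightarrow> (\<forall>y. y \<notin> K \<longrightarrow> \<phi> y = 0) \<longrightarrow>
        (LINT y|lborel. F y * (p y + \<i> * q y)) = 0)"

lemma continuous_on_UNIV_glue:
  fixes p :: "'a::t1_space \<Rightarrow> 'b::topological_space"
  assumes "open U" "x \<in> U" "\<And>y. y \<in> U \<Longrightarrow> p y = c" "continuous_on (- {x}) p"
  shows "continuous_on UNIV p"
proof -
  have "continuous_on U p"
    using assms(3) by (subst continuous_on_cong[OF refl, of U p "\<lambda>_. c"]) auto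
  then have "continuous_on (U \<union> - {x}) p"
    using assms by (intro continuous_on_open_Un) auto
  moreover have "U \<union> - {x} = UNIV" using assms by auto
  ultimately show ?thesis by simp
qed

text \<open>
  The kernel lives on the annulus \<open>r \<le> \<bar>y - a\<bar> \<le> 2 r\<close>, so the singularity at \<open>x\<close> stays at
  distance at least \<open>d\<close> from its support.
\<close>

lemma cauchy_kernel_bound:
  assumes r: "0 < r" and x: "d \<le> r - dist x a" "0 < d"
  shows "norm (of_real (annular_bump r (y - a)) * cplx (y - a) / (cplx y - cplx x)) \<le> 8 / (r * d)"
proof (cases "norm (y - a) \<le> r \<or> 2 * r \<le> norm (y - a)")
  case True
  then show ?thesis using annular_bump_eq_0[OF r True] assms by simp
next
  case False
  have "d \<le> norm (y - x)"
    using False x norm_triangle_ineq[of "y - x" "x - a"] by (simp add: dist_norm)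
  moreover have "annular_bump r (y - a) * norm (y - a) \<le> (4 / r\<^sup>2) * (2 * r)"
    using False annular_bump_le by (intro mult_mono) (auto simp: annular_bump_nonneg)
  ultimately have "annular_bump r (y - a) * norm (y - a) / norm (y - x) \<le> (4 / r\<^sup>2) * (2 * r) / d"
    using x r by (intro frac_le) auto
  also have "\<dots> = 8 / (r * d)" using r by (simp add: power2_eq_square)
  finally show ?thesis
    by (simp add: norm_mult norm_divide annular_bump_nonneg flip: cplx_diff)
qed

text \<open>
  The test function is \<open>\<phi> y = N y / (y - x)\<close>, where \<open>N\<close> is the difference of the cutoffs at \<open>a\<close> and at
  \<open>x\<close>. Both cutoffs equal \<open>1\<close> near \<open>x\<close>, so \<open>\<phi>\<close> vanishes there and is \<open>C\<^sup>1\<close> in spite of the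
  denominator. Since \<open>D\<^sub>1 + \<i> D\<^sub>2\<close> annihilates \<open>1 / (y - x)\<close>, it only acts on \<open>N\<close>, whose gradient \<open>G\<close> is
  radial about \<open>a\<close> and about \<open>x\<close> respectively; the second part cancels the denominator.
\<close>

lemma annular_mean_eq_cauchy_integral:
  fixes F :: "real^2 \<Rightarrow> complex"
  assumes F: "integrable lborel F" and weak: "weakly_dbar_closed (cball a (2 * r)) F"
    and e: "0 < e" and x: "dist x a + 2 * e \<le> r"
  shows "(LINT y|lborel. F y * of_real (annular_bump e (y - x))) =
    (LINT y|lborel. F y * (of_real (annular_bump r (y - a)) * cplx (y - a) / (cplx y - cplx x)))"
proof -
  have r: "0 < r" using e x zero_le_dist[of x a] by linarith
  define N where "N y = radial_cutoff r (y - a) - radial_cutoff e (y - x)" for y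
  define G where "G y = (-2 * annular_bump r (y - a)) *\<^sub>R (y - a) - (-2 * annular_bump e (y - x)) *\<^sub>R (y - x)" for y
  define \<phi> where "\<phi> y = of_real (N y) / cplx (y - x)" for y
  define p where "p y = of_real (G y $ 1) / cplx (y - x) - of_real (N y) / (cplx (y - x))\<^sup>2" for y
  define q where "q y = of_real (G y $ 2) / cplx (y - x) - \<i> * of_real (N y) / (cplx (y - x))\<^sup>2" for y
  have N': "(N has_derivative (\<lambda>h. G y \<bullet> h)) (at y)" for y
    unfolding N_def[abs_def]
    by (rule has_derivative_eq_rhs[OF has_derivative_diff[OF
         radial_cutoff_has_derivative radial_cutoff_has_derivative]])
       (simp add: G_def inner_diff_left fun_eq_iff)
  have N0: "N y = 0" if "y \<in> ball x e" for y
  proof -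
    have "norm (y - a) \<le> r" "norm (y - x) \<le> e"
      using that x e dist_triangle[of y a x] by (auto simp: dist_norm norm_minus_commute)
    then show ?thesis using r e by (simp add: N_def radial_cutoff_eq_1)
  qed
  have G0: "G y = 0" if "y \<in> ball x e" for y
  proof -
    have "norm (y - a) \<le> r" "norm (y - x) \<le> e"
      using that x e dist_triangle[of y a x] by (auto simp: dist_norm norm_minus_commute)
    then show ?thesis using r e by (simp add: G_def annular_bump_eq_0)
  qed
  have Nc: "continuous_on UNIV N"
    using N' by (intro has_derivative_continuous_on) (auto intro: has_derivative_at_withinI)
  have Gc: "continuous_on UNIV G"
    unfolding G_def by (intro continuous_intros continuous_on_compose2[OF annular_bump_continuous]) auto
  have deriv: "(\<phi> has_derivative (\<lambda>h. h$1 *\<^sub>R p y + h$2 *\<^sub>R q y)) (at y)" for y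
  proof (cases "y = x")
    case True
    have "(\<phi> has_derivative (\<lambda>h. 0)) (at x)"
      by (rule has_derivative_transform_within_open[of "\<lambda>_. 0" _ _ UNIV "ball x e"])
        (use e in \<open>auto simp: \<phi>_def N0\<close>)
    moreover have "p x = 0" "q x = 0" by (simp_all add: p_def q_def cplx_def flip: zero_complex.code)
    ultimately show ?thesis using True by simp
  next
    case False
    then have nz: "cplx (y - x) \<noteq> 0" by simp
    have "(\<phi> has_derivative (\<lambda>h. (of_real (G y \<bullet> h) * cplx (y - x) - of_real (N y) * cplx h)
             / (cplx (y - x) * cplx (y - x)))) (at y)"
      unfolding \<phi>_def[abs_def] using nz
      by (auto intro!: derivative_eq_intros N')
    moreover have "(of_real (G y \<bullet> h) * cplx (y - x) - of_real (N y) * cplx h) / (cplx (y - x) * cplx (y - x))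
        = h$1 *\<^sub>R p y + h$2 *\<^sub>R q y" for h
    proof -
      define w where "w = cplx (y - x)"
      have "w \<noteq> 0" using nz by (simp add: w_def)
      moreover have "cplx h = of_real (h$1) + \<i> * of_real (h$2)"
        by (simp add: complex_eq_iff)
      ultimately show ?thesis
        unfolding p_def q_def w_def [symmetric]
        by (simp add: inner_vec_def sum_2 scaleR_conv_of_real power2_eq_square field_simps)
    qed
    ultimately show ?thesis by (elim has_derivative_eq_rhs) (simp add: fun_eq_iff)
  qed
  have pc: "continuous_on UNIV p"
    by (rule continuous_on_UNIV_glue[of "ball x e" x p 0])
      (use e in \<open>auto simp: p_def N0 G0 intro!: continuous_intros continuous_on_subset[OF Nc] continuous_on_subset[OF Gc]\<close>)
  have qc: "continuous_on UNIV q"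
    by (rule continuous_on_UNIV_glue[of "ball x e" x q 0])
      (use e in \<open>auto simp: q_def N0 G0 intro!: continuous_intros continuous_on_subset[OF Nc] continuous_on_subset[OF Gc]\<close>)
  have supp: "\<phi> y = 0" if "y \<notin> cball a (2 * r)" for y
  proof -
    have "2 * r \<le> norm (y - a)" "2 * e \<le> norm (y - x)"
      using that x e r dist_triangle[of a y x] by (auto simp: dist_norm norm_minus_commute)
    then show ?thesis using r e by (simp add: \<phi>_def N_def radial_cutoff_eq_0)
  qed
  let ?A = "\<lambda>y. F y * of_real (annular_bump e (y - x))"
  let ?B = "\<lambda>y. F y * (of_real (annular_bump r (y - a)) * cplx (y - a) / (cplx y - cplx x))"
  have pq: "p y + \<i> * q y = 2 * of_real (annular_bump e (y - x)) -
      2 * (of_real (annular_bump r (y - a)) * cplx (y - a) / (cplx y - cplx x))" for y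
  proof (cases "y = x")
    case True
    then show ?thesis using e by (simp add: p_def q_def annular_bump_eq_0 cplx_def flip: zero_complex.code)
  next
    case False
    then have nz: "cplx (y - x) \<noteq> 0" by simp
    have "cplx (G y) = of_real (G y $ 1) + \<i> * of_real (G y $ 2)"
      by (simp add: complex_eq_iff)
    then have "p y + \<i> * q y = cplx (G y) / cplx (y - x)"
      using nz by (simp add: p_def q_def field_simps power2_eq_square)
    also have "cplx (G y) = -2 * of_real (annular_bump r (y - a)) * cplx (y - a)
        + 2 * of_real (annular_bump e (y - x)) * cplx (y - x)"
      by (simp add: complex_eq_iff G_def)
    finally show ?thesis using nz by (simp add: add_divide_distrib diff_divide_distrib cplx_diff[of y x])
  qed
  have AB: "?A y - ?B y = F y * (p y + \<i> * q y) / 2" for y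
  proof -
    have "u * s - u * t = u * (2 * s - 2 * t) / 2" for u s t :: complex
      by (simp add: field_simps)
    then show ?thesis unfolding pq .
  qed
  have "(LINT y|lborel. F y * (p y + \<i> * q y)) = 0"
    using weak[unfolded weakly_dbar_closed_def] deriv pc qc supp by blast
  then have "(LINT y|lborel. ?A y - ?B y) = 0"
    unfolding AB by simp
  moreover have "integrable lborel ?A"
    using annular_bump_le annular_bump_nonneg
    by (intro integrable_mult_bounded[OF F, where B="4 / e\<^sup>2"]) auto
  moreover have "integrable lborel ?B"
    using e x by (intro integrable_mult_bounded[OF F _ cauchy_kernel_bound[of r "2*e"]] r) auto
  ultimately show ?thesis by simp
qed

text \<open>
  Differentiation under the integral sign. The remainder of the difference quotient is
  \<open>h H / ((y - z - h) (y - z)\<^sup>2)\<close>, and on the support of \<open>H\<close> the denominators stay away from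
  \<open>0\<close>, uniformly for small \<open>h\<close>.
\<close>

lemma cauchy_integral_holomorphic:
  fixes H :: "real^2 \<Rightarrow> complex"
  assumes H: "integrable lborel H" and zero: "\<And>y. dist y a < r \<Longrightarrow> H y = 0"
  shows "(\<lambda>z. LINT y|lborel. H y / (cplx y - z)) holomorphic_on ball (cplx a) r"
proof -
  let ?G = "\<lambda>z. LINT y|lborel. H y / (cplx y - z)"
  have [measurable]: "H \<in> borel_measurable borel"
    using borel_measurable_integrable[OF H] by simp
  have "\<exists>D. (?G has_field_derivative D) (at z)" if z: "z \<in> ball (cplx a) r" for z
  proof -
    \<comment> \<open>Points closer than \<open>d / 2\<close> to \<open>z\<close> keep distance \<open>d / 2\<close> from the support of \<open>H\<close>.\<close>
    define d where "d = r - dist z (cplx a)"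
    have d: "0 < d" using z by (simp add: d_def dist_commute)
    have far: "d / 2 \<le> norm (cplx y - w)" if "H y \<noteq> 0" "norm (w - z) < d / 2" for y w
    proof -
      have "r \<le> dist (cplx y) (cplx a)" using zero that(1) by (force simp: not_less[symmetric])
      also have "\<dots> \<le> dist (cplx y) w + dist w z + dist z (cplx a)"
        using dist_triangle[of "cplx y" "cplx a" w] dist_triangle[of w "cplx a" z] by linarith
      finally show ?thesis using that(2) by (simp add: d_def dist_norm)
    qed
    have int: "integrable lborel (\<lambda>y. H y / ((cplx y - w) * (cplx y - u) ^ n))"
      if "norm (w - z) < d / 2" "norm (u - z) < d / 2" for w u n
    proof (rule Bochner_Integration.integrable_bound)
      show "integrable lborel (\<lambda>y. norm (H y) / ((d/2) * (d/2) ^ n))" using H by simp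
      show "AE y in lborel. norm (H y / ((cplx y - w) * (cplx y - u) ^ n)) \<le> norm (norm (H y) / ((d/2) * (d/2) ^ n))"
      proof (intro always_eventually allI)
        fix y
        show "norm (H y / ((cplx y - w) * (cplx y - u) ^ n)) \<le> norm (norm (H y) / ((d/2) * (d/2) ^ n))"
        proof (cases "H y = 0")
          case False
          have "norm (H y) / (norm (cplx y - w) * norm (cplx y - u) ^ n) \<le> norm (H y) / ((d/2) * (d/2) ^ n)"
            using far[OF False that(1)] far[OF False that(2)] d
            by (intro divide_left_mono mult_mono power_mono mult_pos_pos zero_less_power) auto
          then show ?thesis using d by (simp add: norm_divide norm_mult norm_power)
        qed simp
      qed
    qed measurable
    define D where "D = (LINT y|lborel. H y / (cplx y - z)\<^sup>2)"
    define M where "M = (LINT y|lborel. norm (H y) / (d/2)^3)"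
    have est: "norm ((?G (z + h) - ?G z) / h - D) \<le> norm h * M" if h: "norm h < d / 2" "h \<noteq> 0" for h
    proof -
      have i0: "integrable lborel (\<lambda>y. H y / (cplx y - (z + h)))"
        using int[of "z + h" z 0] h d by simp
      have i1: "integrable lborel (\<lambda>y. H y / (cplx y - z))"
        using int[of z z 0] d by simp
      have i2: "integrable lborel (\<lambda>y. H y / (cplx y - z)\<^sup>2)"
        using int[of z z 1] d by (simp add: power2_eq_square)
      have i3: "integrable lborel (\<lambda>y. H y / ((cplx y - (z + h)) * (cplx y - z)\<^sup>2))"
        using int[of "z + h" z 2] h d by simp
      have "(?G (z + h) - ?G z) / h - D =
          (LINT y|lborel. (H y / (cplx y - (z + h)) - H y / (cplx y - z)) / h - H y / (cplx y - z)\<^sup>2)"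
        unfolding D_def using i0 i1 i2 by simp
      also have "\<dots> = (LINT y|lborel. h * (H y / ((cplx y - (z + h)) * (cplx y - z)\<^sup>2)))"
      proof (rule Bochner_Integration.integral_cong[OF refl])
        fix y
        show "(H y / (cplx y - (z + h)) - H y / (cplx y - z)) / h - H y / (cplx y - z)\<^sup>2 =
            h * (H y / ((cplx y - (z + h)) * (cplx y - z)\<^sup>2))"
        proof (cases "H y = 0")
          case False
          have "cplx y - (z + h) \<noteq> 0" "cplx y - z \<noteq> 0"
            using far[OF False, of "z + h"] far[OF False, of z] h d by auto
          then show ?thesis using h by (simp add: divide_simps) algebra
        qed simp
      qed
      also have "norm \<dots> \<le> norm h * (LINT y|lborel. norm (H y) / (d/2)^3)"
        unfolding integral_mult_right_zero norm_mult
      proof (rule mult_left_mono)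
        show "norm (LINT y|lborel. H y / ((cplx y - (z + h)) * (cplx y - z)\<^sup>2)) \<le> (LINT y|lborel. norm (H y) / (d/2)^3)"
        proof (rule Bochner_Integration.integral_norm_bound_integral[OF i3])
          show "integrable lborel (\<lambda>y. norm (H y) / (d/2)^3)" using H by simp
          fix y
          show "norm (H y / ((cplx y - (z + h)) * (cplx y - z)\<^sup>2)) \<le> norm (H y) / (d/2)^3"
          proof (cases "H y = 0")
            case False
            have "norm (H y) / (norm (cplx y - (z + h)) * norm (cplx y - z) ^ 2) \<le> norm (H y) / ((d/2) * (d/2) ^ 2)"
              using far[OF False, of "z + h"] far[OF False, of z] h d
              by (intro divide_left_mono mult_mono power_mono mult_pos_pos zero_less_power) auto
            then show ?thesis using d by (simp add: norm_divide norm_mult norm_power power_numeral_reduce)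
          qed simp
        qed
      qed simp
      finally show ?thesis unfolding M_def .
    qed
    have "(\<lambda>h. (?G (z + h) - ?G z) / h - D) \<midarrow>0\<rightarrow> 0"
    proof (rule Lim_null_comparison)
      show "\<forall>\<^sub>F h in at 0. norm ((?G (z + h) - ?G z) / h - D) \<le> norm h * M"
        unfolding eventually_at using d by (intro exI[of _ "d/2"]) (auto intro!: est)
      show "((\<lambda>h. norm h * M) \<longlongrightarrow> 0) (at 0)" by (auto intro!: tendsto_eq_intros)
    qed
    then have "(?G has_field_derivative D) (at z)"
      unfolding DERIV_def by (simp add: LIM_zero_iff)
    then show ?thesis by blast
  qed
  then show ?thesis
    unfolding holomorphic_on_def field_differentiable_def
    by (meson has_field_derivative_at_within)
qed

section \<open>Annular means as an approximate identity\<close>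

lemma annular_bump_integrable: "0 < r \<Longrightarrow> integrable lborel (\<lambda>x. annular_bump r (y - x))"
proof (rule Bochner_Integration.integrable_bound)
  assume r: "0 < r"
  show "integrable lborel (\<lambda>x. 4 / r\<^sup>2 * indicator (cball y (2 * r)) x :: real)"
    using emeasure_bounded_finite[OF bounded_cball, of y "2 * r"]
    by (intro integrable_mult_right integrable_real_indicator) auto
  have "annular_bump r (y - x) \<le> 4 / r\<^sup>2 * indicator (cball y (2 * r)) x" for x
    using annular_bump_le[of r "y - x"] annular_bump_eq_0[OF r, of "y - x"]
    by (auto simp: indicator_def dist_norm)
  then show "AE x in lborel. norm (annular_bump r (y - x)) \<le> norm (4 / r\<^sup>2 * indicator (cball y (2 * r)) x :: real)"
    by (simp add: annular_bump_nonneg)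
qed measurable

text \<open>
  The written form \<open>0 - w\<close> matches the convolutions below, of which this is the one at the origin.
\<close>

definition bump_mass :: real where
  "bump_mass = (LINT w|lborel. annular_bump 1 (0 - w))"

lemma integral_annular_bump:
  assumes e: "0 < e"
  shows "(LINT x|lborel. annular_bump e (y - x)) = bump_mass"
proof -
  have "(LINT x|lborel. annular_bump e (y - x)) =
      (LINT x|density (distr lborel borel (\<lambda>x. y + e *\<^sub>R x)) (\<lambda>_. ennreal (\<bar>e\<bar> ^ DIM(real^2))). annular_bump e (y - x))"
    using lborel_affine[of e y] e by simp
  also have "\<dots> = (LINT x|distr lborel borel (\<lambda>x. y + e *\<^sub>R x). \<bar>e\<bar>\<^sup>2 *\<^sub>R annular_bump e (y - x))"
    by (subst integral_density) (auto simp: measurable_distr_eq1)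
  also have "\<dots> = (LINT x|lborel. \<bar>e\<bar>\<^sup>2 *\<^sub>R annular_bump e (y - (y + e *\<^sub>R x)))"
    by (subst integral_distr) auto
  also have "\<dots> = bump_mass"
    unfolding bump_mass_def using e by (simp add: annular_bump_def)
  finally show ?thesis .
qed

lemma bump_mass_pos: "0 < bump_mass"
proof -
  have "bump_mass \<noteq> 0"
  proof
    assume "bump_mass = 0"
    then have "AE w in lborel. annular_bump 1 (0 - w) = 0"
      unfolding bump_mass_def
      by (subst (asm) integral_nonneg_eq_0_iff_AE)
        (use annular_bump_integrable[of 1 0] in \<open>auto simp: annular_bump_nonneg\<close>)
    then have "AE w in lebesgue. w \<in> {w. annular_bump 1 (0 - w) = 0}"
      by (intro AE_completion) simp
    moreover have "closed {w. annular_bump 1 (0 - w) = 0}"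
      by (intro closed_Collect_eq continuous_intros continuous_on_compose2[OF annular_bump_continuous]) auto
    ultimately have z: "annular_bump 1 (0 - w) = 0" for w
      using mem_closed_if_AE_lebesgue by blast
    \<comment> \<open>Any number strictly between \<open>1\<close> and \<open>2\<close> serves as the squared radius.\<close>
    have "bump (5/4) > 0"
      by (simp add: bump_def pos_sq_def power2_eq_square)
    moreover have "annular_bump 1 (0 - sqrt (5/4) *\<^sub>R axis 1 1) = bump (5/4)"
      by (simp add: annular_bump_def norm_axis_1)
    ultimately show False using z by simp
  qed
  moreover have "0 \<le> bump_mass"
    unfolding bump_mass_def by (intro integral_nonneg_AE) (simp add: annular_bump_nonneg)
  ultimately show ?thesis by simp
qed

text \<open>
  The sets over which \<open>f\<close> integrates to \<open>0\<close> form a Dynkin system that contains the boxes, which are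
  stable under intersection and generate the Borel sets.
\<close>

lemma AE_eq_0_if_box_integrals_eq_0:
  fixes f :: "real^2 \<Rightarrow> complex"
  assumes f: "integrable lborel f"
    and box: "\<And>l u. (LINT x|lborel. indicator (box l u) x *\<^sub>R f x) = 0"
  shows "AE x in lborel. f x = 0"
proof -
  have [measurable]: "f \<in> borel_measurable borel"
    using borel_measurable_integrable[OF f] by simp
  have set_int: "set_integrable lborel A f" if "A \<in> sets borel" for A
    unfolding set_integrable_def using f that by (intro integrable_mult_indicator) auto
  have all: "(LINT x|lborel. f x) = 0"
  proof -
    \<comment> \<open>Complements need the integral over the whole plane, which is exhausted by boxes.\<close>
    let ?A = "\<lambda>n::nat. box (- (real n *\<^sub>R One)) (real n *\<^sub>R One) :: (real^2) set"
    have "(\<lambda>n. LINT x|lborel. indicator (?A n) x *\<^sub>R f x) \<longlonglongrightarrow> (LINT x|lborel. f x)"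
    proof (rule integral_dominated_convergence[where w="\<lambda>x. norm (f x)"])
      show "AE x in lborel. (\<lambda>n. indicator (?A n) x *\<^sub>R f x) \<longlonglongrightarrow> f x"
      proof (intro always_eventually allI)
        fix x :: "real^2"
        obtain N where N: "x \<in> ?A N" using UN_box_eq_UNIV by blast
        have "indicator (?A n) x *\<^sub>R f x = f x" if "N \<le> n" for n
        proof -
          have "real N \<le> real n" using that by simp
          then have "- real n < x \<bullet> i \<and> x \<bullet> i < real n" if "i \<in> Basis" for i
            using N that by (fastforce simp: mem_box)
          then have "x \<in> ?A n" by (simp add: mem_box)
          then show ?thesis by simp
        qed
        then show "(\<lambda>n. indicator (?A n) x *\<^sub>R f x) \<longlonglongrightarrow> f x"
          by (intro tendsto_eventually) (auto simp: eventually_sequentially)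
      qed
    qed (use f in \<open>auto simp: indicator_def\<close>)
    then show ?thesis unfolding box by (simp add: LIMSEQ_const_iff)
  qed
  have zero: "(LINT x:A|lborel. f x) = 0" if A: "A \<in> sets borel" for A
  proof -
    let ?E = "range (\<lambda>(a, b). box a b :: (real^2) set)"
    have "Int_stable ?E" by (auto simp: Int_stable_def box_Int_box)
    moreover have "?E \<subseteq> Pow UNIV" by simp
    moreover have sb: "sets borel = sigma_sets UNIV ?E" by (simp add: borel_eq_box)
    then have "A \<in> sigma_sets UNIV ?E" using A by simp
    ultimately show ?thesis
    proof (induction rule: sigma_sets_induct_disjoint)
      case (basic A)
      then show ?case using box by (auto simp: set_lebesgue_integral_def)
    next
      case empty
      then show ?case by (simp add: set_lebesgue_integral_def)
    next
      case (compl A)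
      have A: "A \<in> sets borel" using compl sb by simp
      have "(LINT x:UNIV|lborel. f x) = (LINT x:A \<union> (UNIV - A)|lborel. f x)" by simp
      also have "\<dots> = (LINT x:A|lborel. f x) + (LINT x:UNIV - A|lborel. f x)"
        using A by (intro set_integral_Un set_int) auto
      finally show ?case using compl all by (simp add: set_lebesgue_integral_def)
    next
      case (union A)
      then have "\<And>i. A i \<in> sets borel" using sb by auto
      then have "(LINT x:(\<Union>i. A i)|lborel. f x) = (\<Sum>i. (LINT x:A i|lborel. f x))"
        using union by (intro lebesgue_integral_countable_add set_int) (auto simp: disjoint_family_on_def)
      then show ?case using union by simp
    qed
  qed
  have re: "AE x in lborel. Re (f x) = 0"
  proof (rule density_unique_real)
    fix A :: "(real^2) set" assume A: "A \<in> sets lborel"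
    have "(LINT x:A|lborel. Re (f x)) = Re (LINT x:A|lborel. f x)"
      unfolding set_lebesgue_integral_def
      using set_int[of A] A by (subst integral_Re[symmetric]) (auto simp: set_integrable_def)
    then show "(LINT x:A|lborel. Re (f x)) = (LINT x:A|lborel. 0)"
      using zero A by simp
  qed (use f in auto)
  have im: "AE x in lborel. Im (f x) = 0"
  proof (rule density_unique_real)
    fix A :: "(real^2) set" assume A: "A \<in> sets lborel"
    have "(LINT x:A|lborel. Im (f x)) = Im (LINT x:A|lborel. f x)"
      unfolding set_lebesgue_integral_def
      using set_int[of A] A by (subst integral_Im[symmetric]) (auto simp: set_integrable_def)
    then show "(LINT x:A|lborel. Im (f x)) = (LINT x:A|lborel. 0)"
      using zero A by simp
  qed (use f in auto)
  from re im show ?thesis by eventually_elim (simp add: complex_eq_iff)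
qed

text \<open>
  Off the frontier, \<open>Q\<close> or its complement contains a ball about \<open>y\<close>, and once the support of the
  kernel fits into that ball the mean has its limiting value exactly.
\<close>

lemma annular_mean_of_indicator_tendsto:
  fixes Q :: "(real^2) set"
  assumes [measurable]: "Q \<in> sets borel" and y: "y \<notin> frontier Q"
    and e: "\<And>n. 0 < e n" "e \<longlonglongrightarrow> 0"
  shows "(\<lambda>n. LINT x|lborel. indicator Q x * annular_bump (e n) (y - x)) \<longlonglongrightarrow>
    bump_mass * indicator Q y"
proof (rule tendsto_eventually)
  have "y \<in> interior Q \<or> y \<in> interior (- Q)"
    using y by (auto simp: frontier_def interior_closure)
  then obtain d where d: "0 < d" "ball y d \<subseteq> Q \<or> ball y d \<subseteq> - Q"
    by (auto simp: mem_interior)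
  have "\<forall>\<^sub>F n in sequentially. 2 * e n < d"
    using order_tendstoD(2)[OF e(2), of "d / 2"] d(1) by (simp add: mult.commute pos_less_divide_eq)
  then show "\<forall>\<^sub>F n in sequentially. (LINT x|lborel. indicator Q x * annular_bump (e n) (y - x)) =
      bump_mass * indicator Q y"
  proof eventually_elim
    case (elim n)
    have "indicator Q x * annular_bump (e n) (y - x) = indicator Q y * annular_bump (e n) (y - x)" for x
    proof (cases "x \<in> ball y d")
      case True
      moreover have "y \<in> ball y d" using d by simp
      ultimately have "x \<in> Q \<longleftrightarrow> y \<in> Q" using d(2) by blast
      then show ?thesis by (simp add: indicator_def)
    next
      case False
      then show ?thesis using elim annular_bump_eq_0[OF e(1)[of n], of "y - x"] by (simp add: dist_norm)
    qed
    then have "(LINT x|lborel. indicator Q x * annular_bump (e n) (y - x)) =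
        (LINT x|lborel. indicator Q y * annular_bump (e n) (y - x))"
      by presburger
    then show ?case using integral_annular_bump[OF e(1)[of n], of y] by simp
  qed
qed

text \<open>
  The kernel depends on \<open>y - x\<close> only, so averaging \<open>F\<close> and integrating over \<open>Q\<close> amounts to
  integrating \<open>F\<close> against the average of the indicator of \<open>Q\<close>; in this form the limit of
  shrinking annuli is accessible.
\<close>

lemma annular_mean_fubini:
  fixes F :: "real^2 \<Rightarrow> complex"
  assumes F: "integrable lborel F" and Q: "Q \<in> sets borel" "bounded Q" and e: "0 < e"
  shows "(LINT x|lborel. indicator Q x *\<^sub>R (LINT y|lborel. F y * of_real (annular_bump e (y - x)))) =
    (LINT y|lborel. F y * of_real (LINT x|lborel. indicator Q x * annular_bump e (y - x)))"
proof -
  note Q(1) [measurable]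
  have [measurable]: "F \<in> borel_measurable borel"
    using borel_measurable_integrable[OF F] by simp
  let ?P = "\<lambda>(x, y). indicator Q x *\<^sub>R (F y * of_real (annular_bump e (y - x)))"
  have fin: "emeasure lborel Q < \<infinity>" by (rule emeasure_bounded_finite[OF Q(2)])
  have "integrable (lborel \<Otimes>\<^sub>M lborel) (\<lambda>(x, y). indicator Q x *\<^sub>R (of_real (4 / e\<^sup>2) * F y))"
  proof (rule lborel_pair.Fubini_integrable)
    show "integrable lborel (\<lambda>x. LINT y|lborel. norm (case (x, y) of (x, y) \<Rightarrow> indicator Q x *\<^sub>R (of_real (4 / e\<^sup>2) * F y)))"
      using fin Q by (simp add: integrable_real_indicator)
    show "AE x in lborel. integrable lborel (\<lambda>y. case (x, y) of (x, y) \<Rightarrow> indicator Q x *\<^sub>R (of_real (4 / e\<^sup>2) * F y))"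
      using F by simp
  qed measurable
  then have int: "integrable (lborel \<Otimes>\<^sub>M lborel) ?P"
  proof (rule Bochner_Integration.integrable_bound)
    show "AE z in lborel \<Otimes>\<^sub>M lborel. norm (?P z) \<le> norm (case z of (x, y) \<Rightarrow> indicator Q x *\<^sub>R (of_real (4 / e\<^sup>2) * F y))"
    proof (intro always_eventually allI)
      fix z :: "(real^2) \<times> (real^2)"
      obtain x y where "z = (x, y)" by (cases z)
      moreover have "norm (F y) * annular_bump e (y - x) \<le> norm (F y) * (4 / e\<^sup>2)"
        by (intro mult_left_mono annular_bump_le) auto
      ultimately show "norm (?P z) \<le> norm (case z of (x, y) \<Rightarrow> indicator Q x *\<^sub>R (of_real (4 / e\<^sup>2) * F y))"
        by (simp add: norm_mult norm_divide norm_power annular_bump_nonneg indicator_def mult.commute)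
    qed
  qed measurable
  have "(LINT x|lborel. indicator Q x *\<^sub>R (LINT y|lborel. F y * of_real (annular_bump e (y - x)))) =
      (LINT x|lborel. LINT y|lborel. indicator Q x *\<^sub>R (F y * of_real (annular_bump e (y - x))))"
    by simp
  also have "\<dots> = (LINT y|lborel. LINT x|lborel. indicator Q x *\<^sub>R (F y * of_real (annular_bump e (y - x))))"
    by (rule lborel_pair.Fubini_integral[symmetric, OF int])
  also have "\<dots> = (LINT y|lborel. F y * of_real (LINT x|lborel. indicator Q x * annular_bump e (y - x)))"
  proof (rule Bochner_Integration.integral_cong[OF refl])
    fix y
    have "(LINT x|lborel. indicator Q x *\<^sub>R (F y * of_real (annular_bump e (y - x)))) =
        (LINT x|lborel. F y * of_real (indicator Q x * annular_bump e (y - x)))"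
      by (rule Bochner_Integration.integral_cong) (simp_all add: scaleR_conv_of_real mult_ac)
    also have "\<dots> = F y * of_real (LINT x|lborel. indicator Q x * annular_bump e (y - x))"
      by (simp only: integral_mult_right_zero integral_complex_of_real)
    finally show "(LINT x|lborel. indicator Q x *\<^sub>R (F y * of_real (annular_bump e (y - x)))) =
        F y * of_real (LINT x|lborel. indicator Q x * annular_bump e (y - x))" .
  qed
  finally show ?thesis .
qed

section \<open>Weyl's lemma for the Cauchy--Riemann operator\<close>

text \<open>
  On the smaller disc the annular means with \<open>e \<le> r / 4\<close> all equal the Cauchy integral, up to the mass
  of the kernel. Integrating this identity over a piece \<open>Q\<close> of a box and letting \<open>e\<close> tend to \<open>0\<close> shows that
  \<open>F\<close> and the Cauchy integral have the same integral over \<open>Q\<close>.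
\<close>

lemma weyl_dbar_local:
  fixes F :: "real^2 \<Rightarrow> complex"
  assumes F: "integrable lborel F" and weak: "weakly_dbar_closed (cball a (2 * r)) F" and r: "0 < r"
  shows "\<exists>g. g holomorphic_on ball (cplx a) (r / 2) \<and>
    (AE y in lborel. y \<in> ball a (r / 2) \<longrightarrow> F y = g (cplx y))"
proof -
  let ?B = "ball a (r / 2)"
  have [measurable]: "F \<in> borel_measurable borel"
    using borel_measurable_integrable[OF F] by simp
  define H where "H y = F y * (of_real (annular_bump r (y - a)) * cplx (y - a))" for y
  define g where "g z = (LINT y|lborel. H y / (cplx y - z)) / of_real bump_mass" for z
  have H: "integrable lborel H"
    unfolding H_def
  proof (rule integrable_mult_bounded[OF F])
    show "norm (of_real (annular_bump r (y - a)) * cplx (y - a)) \<le> (4 / r\<^sup>2) * (2 * r)" for y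
    proof (cases "norm (y - a) \<le> 2 * r")
      case True
      then show ?thesis unfolding norm_mult
        using r by (intro mult_mono) (auto simp: annular_bump_nonneg annular_bump_le)
    qed (use r in \<open>simp add: annular_bump_eq_0\<close>)
  qed measurable
  have g: "g holomorphic_on ball (cplx a) r"
    unfolding g_def
    by (intro holomorphic_intros cauchy_integral_holomorphic[OF H])
      (use bump_mass_pos r in \<open>auto simp: H_def annular_bump_eq_0 dist_norm\<close>)
  have mean: "(LINT y|lborel. F y * of_real (annular_bump e (y - x))) = of_real bump_mass * g (cplx x)"
    if "0 < e" "dist x a + 2 * e \<le> r" for e x
    using annular_mean_eq_cauchy_integral[OF F weak that] bump_mass_pos
    by (simp add: g_def H_def)
  have gB: "continuous_on (cball a (r / 2)) (\<lambda>x. g (cplx x))"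
    by (rule continuous_on_compose2[OF holomorphic_on_imp_continuous_on[OF g]])
      (use r in \<open>auto intro!: continuous_intros simp: dist_commute\<close>)
  have intg: "integrable lborel (\<lambda>x. indicator ?B x *\<^sub>R g (cplx x))"
  proof -
    have "set_integrable lborel (cball a (r / 2)) (\<lambda>x. g (cplx x))"
      using gB by (intro borel_integrable_compact[of "cball a (r/2)", folded set_integrable_def]) auto
    then have "set_integrable lborel ?B (\<lambda>x. g (cplx x))"
      by (rule set_integrable_subset) auto
    then show ?thesis by (simp add: set_integrable_def)
  qed
  have "AE x in lborel. indicator ?B x *\<^sub>R F x - indicator ?B x *\<^sub>R g (cplx x) = 0"
  proof (rule AE_eq_0_if_box_integrals_eq_0)
    show "integrable lborel (\<lambda>x. indicator ?B x *\<^sub>R F x - indicator ?B x *\<^sub>R g (cplx x))"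
      by (rule Bochner_Integration.integrable_diff[OF integrable_mult_indicator[OF _ F] intg]) simp
    fix l u :: "real^2"
    define Q where "Q = box l u \<inter> ?B"
    have Q: "Q \<in> sets borel" "bounded Q" by (auto simp: Q_def bounded_Int)
    note Q(1) [measurable]
    have Qind: "indicator (box l u) x *\<^sub>R (indicator ?B x *\<^sub>R c) = indicator Q x *\<^sub>R c" for x and c :: complex
      by (simp add: Q_def indicator_inter_arith)
    have intFQ: "integrable lborel (\<lambda>x. indicator Q x *\<^sub>R F x)"
      using F by (intro integrable_mult_indicator) auto
    have intgQ: "integrable lborel (\<lambda>x. indicator Q x *\<^sub>R g (cplx x))"
      using integrable_mult_indicator[OF _ intg, of "box l u"] by (simp only: Qind) simp
    define e where "e n = r / (4 * real (Suc n))" for n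
    have e: "0 < e n" "e n \<le> r / 4" for n
      using r by (auto simp: e_def field_simps)
    have e0: "e \<longlonglongrightarrow> 0"
      unfolding e_def [abs_def] using tendsto_mult_right_zero[OF LIMSEQ_inverse_real_of_nat, of "r / 4"]
      by (simp add: field_simps)
    let ?\<psi> = "\<lambda>n y. LINT x|lborel. indicator Q x * annular_bump (e n) (y - x)"
    have eq: "(LINT y|lborel. F y * of_real (?\<psi> n y)) =
        of_real bump_mass * (LINT x|lborel. indicator Q x *\<^sub>R g (cplx x))" for n
    proof -
      have "(LINT y|lborel. F y * of_real (?\<psi> n y)) =
          (LINT x|lborel. indicator Q x *\<^sub>R (LINT y|lborel. F y * of_real (annular_bump (e n) (y - x))))"
        by (rule annular_mean_fubini[symmetric, OF F Q e(1)])
      also have "\<dots> = (LINT x|lborel. of_real bump_mass * (indicator Q x *\<^sub>R g (cplx x)))"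
      proof (rule Bochner_Integration.integral_cong[OF refl])
        fix x
        show "indicator Q x *\<^sub>R (LINT y|lborel. F y * of_real (annular_bump (e n) (y - x))) =
            of_real bump_mass * (indicator Q x *\<^sub>R g (cplx x))"
          using mean[OF e(1), of x n] e(2)[of n] by (auto simp: Q_def indicator_def dist_commute)
      qed
      finally show ?thesis by (simp only: integral_mult_right_zero)
    qed
    \<comment> \<open>\<open>Q\<close> is convex, so its frontier, where the averaged indicators may fail to converge, is a null set.\<close>
    have "(\<lambda>n. LINT y|lborel. F y * of_real (?\<psi> n y)) \<longlonglongrightarrow>
        (LINT y|lborel. F y * of_real (bump_mass * indicator Q y))"
    proof (rule integral_dominated_convergence[where w="\<lambda>y. norm (F y) * bump_mass"])
      have "negligible (frontier Q)"
        by (intro negligible_convex_frontier) (simp add: Q_def convex_Int)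
      then have "AE y in lebesgue. y \<notin> frontier Q"
        by (intro AE_not_in) (simp add: negligible_iff_null_sets)
      then have "AE y in lborel. y \<notin> frontier Q"
        by (simp add: AE_completion_iff)
      then show "AE y in lborel. (\<lambda>n. F y * of_real (?\<psi> n y)) \<longlonglongrightarrow> F y * of_real (bump_mass * indicator Q y)"
        by eventually_elim (intro tendsto_intros annular_mean_of_indicator_tendsto Q e e0)
      have "norm (?\<psi> n y) \<le> bump_mass" for n y
      proof -
        have int: "integrable lborel (\<lambda>x. annular_bump (e n) (y - x))"
          by (rule annular_bump_integrable[OF e(1)])
        have "?\<psi> n y \<le> (LINT x|lborel. annular_bump (e n) (y - x))"
        proof (rule integral_mono[OF _ int])
          show "integrable lborel (\<lambda>x. indicator Q x * annular_bump (e n) (y - x))"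
            using integrable_mult_indicator[OF _ int, of Q] Q by (simp only: real_scaleR_def sets_lborel)
        qed (auto simp: indicator_def annular_bump_nonneg)
        moreover have "0 \<le> ?\<psi> n y"
          by (intro integral_nonneg_AE) (simp add: annular_bump_nonneg)
        ultimately show ?thesis using integral_annular_bump[OF e(1)] by simp
      qed
      then show "AE y in lborel. norm (F y * of_real (?\<psi> n y)) \<le> norm (F y) * bump_mass" for n
        by (simp add: norm_mult mult_left_mono)
    qed (use F in auto)
    then have "of_real bump_mass * (LINT x|lborel. indicator Q x *\<^sub>R g (cplx x)) =
        (LINT y|lborel. F y * of_real (bump_mass * indicator Q y))"
      unfolding eq by (simp add: LIMSEQ_const_iff)
    also have "\<dots> = (LINT y|lborel. of_real bump_mass * (indicator Q y *\<^sub>R F y))"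
      by (rule Bochner_Integration.integral_cong) (auto simp: indicator_def)
    finally have "of_real bump_mass * (LINT x|lborel. indicator Q x *\<^sub>R g (cplx x)) =
        of_real bump_mass * (LINT x|lborel. indicator Q x *\<^sub>R F x)"
      by (simp only: integral_mult_right_zero)
    then have "(LINT x|lborel. indicator Q x *\<^sub>R g (cplx x)) = (LINT x|lborel. indicator Q x *\<^sub>R F x)"
      using bump_mass_pos by simp
    then show "(LINT x|lborel. indicator (box l u) x *\<^sub>R (indicator ?B x *\<^sub>R F x - indicator ?B x *\<^sub>R g (cplx x))) = 0"
      unfolding scaleR_diff_right Qind using intFQ intgQ by simp
  qed
  then have "AE y in lborel. y \<in> ?B \<longrightarrow> F y = g (cplx y)"
    by eventually_elim auto
  moreover have "g holomorphic_on ball (cplx a) (r / 2)"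
    using g by (rule holomorphic_on_subset) (use r in auto)
  ultimately show ?thesis by blast
qed

section \<open>Harmonic fields satisfy the weak Cauchy--Riemann equations\<close>

lemma has_partials_support:
  fixes \<phi> :: "real^2 \<Rightarrow> 'b::real_normed_vector"
  assumes "\<And>y. (\<phi> has_derivative (\<lambda>h. h$1 *\<^sub>R p y + h$2 *\<^sub>R q y)) (at y)"
    and "closed K" "\<And>y. y \<notin> K \<Longrightarrow> \<phi> y = 0" and "y \<notin> K"
  shows "p y = 0" "q y = 0"
proof -
  have "(\<phi> has_derivative (\<lambda>h. 0)) (at y)"
    by (rule has_derivative_transform_within_open[of "\<lambda>_. 0" _ _ UNIV "- K"])
      (use assms in auto)
  then have *: "(\<lambda>h :: real^2. h$1 *\<^sub>R p y + h$2 *\<^sub>R q y) = (\<lambda>h. 0)"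
    by (rule has_derivative_unique[OF assms(1)])
  show "p y = 0" "q y = 0"
    using fun_cong[OF *, of "axis 1 1"] fun_cong[OF *, of "axis 2 1"]
    by (simp_all add: axis_def)
qed

lemma partial_deriv_eq:
  assumes "\<And>y. (\<phi> has_derivative (\<lambda>h. h$1 *\<^sub>R p y + h$2 *\<^sub>R q y)) (at y)"
  shows "partial_deriv 1 \<phi> = p" "partial_deriv 2 \<phi> = q"
  using frechet_derivative_at[OF assms, symmetric]
  by (simp_all add: fun_eq_iff partial_deriv_def axis_def)

lemma C1_compact_supportI:
  fixes \<phi> :: "real^2 \<Rightarrow> real"
  assumes d: "\<And>y. (\<phi> has_derivative (\<lambda>h. h$1 *\<^sub>R p y + h$2 *\<^sub>R q y)) (at y)"
    and c: "continuous_on UNIV p" "continuous_on UNIV q"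
    and K: "compact K" "K \<subseteq> \<Omega>" and supp: "\<And>y. y \<notin> K \<Longrightarrow> \<phi> y = 0"
  shows "\<phi> \<in> C1_compact_support \<Omega>"
proof -
  have "closure {x \<in> \<Omega>. \<phi> x \<noteq> 0} \<subseteq> K"
    using supp K by (intro closure_minimal) (auto intro: compact_imp_closed)
  moreover from this have "compact (closure {x \<in> \<Omega>. \<phi> x \<noteq> 0})"
    using compact_Int_closed[OF K(1), of "closure {x \<in> \<Omega>. \<phi> x \<noteq> 0}"]
    by (simp add: Int_absorb1)
  moreover have "Ck_on 1 \<Omega> \<phi>"
    using d c unfolding One_nat_def Ck_on.simps
    by (auto simp: forall_2 partial_deriv_eq[OF d] differentiable_def intro: continuous_on_subset)
  ultimately show ?thesis using K by (auto simp: C1_compact_support_def)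
qed

text \<open>
  With \<open>f = v\<^sub>1 - \<i> v\<^sub>2\<close> and \<open>\<phi> = \<alpha> + \<i> \<beta>\<close>, the product \<open>f (D\<^sub>1 \<phi> + \<i> D\<^sub>2 \<phi>)\<close> equals
  \<open>(grad \<alpha> \<bullet> v - perp_grad \<beta> \<bullet> v) + \<i> (perp_grad \<alpha> \<bullet> v + grad \<beta> \<bullet> v)\<close>, and each of the four terms
  integrates to \<open>0\<close>. As \<open>v\<close> is only Lebesgue measurable, \<open>F\<close> is a Borel representative of \<open>f\<close> cut off
  outside \<open>K\<close>; Borel measurability is needed for Fubini later on.
\<close>

lemma harmonic_field_weakly_dbar_closed:
  assumes \<Omega>: "open \<Omega>" and v: "harmonic_field \<Omega> v" and K: "compact K" "K \<subseteq> \<Omega>"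
  shows "\<exists>F. integrable lborel F \<and> weakly_dbar_closed K F \<and>
    (AE y in lborel. y \<in> K \<longrightarrow> F y = cnj (cplx (v y)))"
proof -
  have Ks: "K \<in> sets lebesgue" "\<Omega> \<in> sets lebesgue"
    using K \<Omega> by (auto intro: fmeasurableD lmeasurable_compact)
  define u where "u y = indicator K y *\<^sub>R v y" for y
  have "integrable (lebesgue_on K) v"
    using v K by (auto simp: harmonic_field_def L1_loc_field_def)
  then have u: "integrable lebesgue u"
    unfolding u_def [abs_def] using Ks by (subst (asm) integrable_restrict_space) auto
  have "\<exists>f. integrable lborel f \<and> (AE y in lborel. u y $ i = f y)" for i
  proof -
    have i: "integrable lebesgue (\<lambda>y. u y $ i)"
      using integrable_bounded_linear[OF bounded_linear_vec_nth u] by simp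
    then obtain f where f: "f \<in> borel_measurable lborel" "AE y in lborel. u y $ i = f y"
      using completion_ex_borel_measurable_real borel_measurable_integrable by blast
    have "integrable lebesgue f"
      using i by (rule Bochner_Integration.integrable_cong_AE_imp)
        (use f in \<open>auto intro: measurable_completion simp: AE_completion_iff\<close>)
    then show ?thesis using f integrable_completion by blast
  qed
  then obtain f where f: "\<And>i. integrable lborel (f i)" "\<And>i. AE y in lborel. u y $ i = f i y"
    by metis
  have [measurable]: "f i \<in> borel_measurable borel" for i
    using borel_measurable_integrable[OF f(1)] by simp
  define F where "F y = of_real (f 1 y) - \<i> * of_real (f 2 y)" for y
  have F: "integrable lborel F"
    unfolding F_def using f(1) by (intro Bochner_Integration.integrable_diff integrable_mult_right integrable_of_real)
  have FK: "AE y in lborel. y \<in> K \<longrightarrow> F y = cnj (cplx (v y))"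
    using f(2)[of 1] f(2)[of 2] by eventually_elim (auto simp: F_def u_def complex_eq_iff)
  \<comment> \<open>The two defining identities of a harmonic field for one real test function.\<close>
  have test: "integrable lborel (\<lambda>y. p y * f 1 y + q y * f 2 y)"
      "(LINT y|lborel. p y * f 1 y + q y * f 2 y) = 0"
      "integrable lborel (\<lambda>y. q y * f 1 y - p y * f 2 y)"
      "(LINT y|lborel. q y * f 1 y - p y * f 2 y) = 0"
    if d: "\<And>y. (\<psi> has_derivative (\<lambda>h. h$1 *\<^sub>R p y + h$2 *\<^sub>R q y)) (at y)"
    and c: "continuous_on UNIV p" "continuous_on UNIV q" and supp0: "\<forall>y. y \<notin> K \<longrightarrow> \<psi> y = 0"
  for \<psi> p q :: "real^2 \<Rightarrow> real"
  proof -
    have [measurable]: "p \<in> borel_measurable borel" "q \<in> borel_measurable borel"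
      using c by (auto intro: borel_measurable_continuous_onI)
    have supp: "\<psi> y = 0" if "y \<notin> K" for y using supp0 that by simp
    note pq0 = has_partials_support[OF d compact_imp_closed[OF K(1)] supp]
    have mult: "integrable lborel (\<lambda>y. h y * f i y)"
      if h: "continuous_on UNIV h" "\<And>y. y \<notin> K \<Longrightarrow> h y = 0" for h i
    proof -
      have "bounded (h ` K)"
        using h(1) K by (intro compact_imp_bounded compact_continuous_image) (auto intro: continuous_on_subset)
      then obtain B where B: "\<And>y. y \<in> K \<Longrightarrow> norm (h y) \<le> B"
        by (auto simp: bounded_iff)
      have bound: "norm (h y) \<le> max B 0" for y
        using B[of y] h(2)[of y] by (cases "y \<in> K") auto
      have "integrable lborel (\<lambda>y. f i y * h y)"
        by (rule integrable_mult_bounded[OF f(1) borel_measurable_continuous_onI[OF h(1)] bound])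
      then show ?thesis by (simp add: mult.commute)
    qed
    have int: "integrable lborel (\<lambda>y. p y * f i y)" "integrable lborel (\<lambda>y. q y * f i y)" for i
      using mult c pq0 by auto
    show "integrable lborel (\<lambda>y. p y * f 1 y + q y * f 2 y)"
      "integrable lborel (\<lambda>y. q y * f 1 y - p y * f 2 y)"
      using int by auto
    have um [measurable]: "(\<lambda>y. u y $ i) \<in> borel_measurable lebesgue" for i
      using borel_measurable_integrable[OF integrable_bounded_linear[OF bounded_linear_vec_nth u]] by simp
    have [measurable]: "p \<in> borel_measurable lebesgue" "q \<in> borel_measurable lebesgue"
      "f i \<in> borel_measurable lebesgue" for i
      by (auto intro!: measurable_completion)
    have transfer: "(LINT y|lborel. s y * f 1 y + t y * f 2 y) = (LINT y|lebesgue_on \<Omega>. G y \<bullet> v y)"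
      if m: "s \<in> borel_measurable borel" "t \<in> borel_measurable borel"
        and st: "\<And>y. y \<notin> K \<Longrightarrow> s y = 0" "\<And>y. y \<notin> K \<Longrightarrow> t y = 0"
        and G: "\<And>y. G y = vector [s y, t y]" for s t G
    proof -
      note m [measurable]
      have ml [measurable]: "s \<in> borel_measurable lebesgue" "t \<in> borel_measurable lebesgue"
        using m by (auto intro!: measurable_completion)
      have "(LINT y|lborel. s y * f 1 y + t y * f 2 y) = (LINT y|lebesgue. s y * f 1 y + t y * f 2 y)"
        by (rule integral_completion[symmetric]) simp
      also have "\<dots> = (LINT y|lebesgue. s y * u y $ 1 + t y * u y $ 2)"
      proof (rule integral_cong_AE)
        have "AE y in lborel. s y * f 1 y + t y * f 2 y = s y * u y $ 1 + t y * u y $ 2"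
          using f(2)[of 1] f(2)[of 2] by eventually_elim simp
        then show "AE y in lebesgue. s y * f 1 y + t y * f 2 y = s y * u y $ 1 + t y * u y $ 2"
          by (rule AE_completion)
      qed measurable
      also have "\<dots> = (LINT y|lebesgue. indicator \<Omega> y *\<^sub>R (G y \<bullet> v y))"
      proof (rule Bochner_Integration.integral_cong[OF refl])
        show "s y * u y $ 1 + t y * u y $ 2 = indicator \<Omega> y *\<^sub>R (G y \<bullet> v y)" for y
          using K(2) st[of y] by (cases "y \<in> K") (auto simp: u_def G inner_vec_def sum_2)
      qed
      also have "\<dots> = (LINT y|lebesgue_on \<Omega>. G y \<bullet> v y)"
        using Ks by (subst integral_restrict_space) auto
      finally show ?thesis .
    qed
    have \<psi>: "\<psi> \<in> C1_compact_support \<Omega>"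
      by (rule C1_compact_supportI[OF d c K supp])
    have "(LINT y|lebesgue_on \<Omega>. grad \<psi> y \<bullet> v y) = 0"
      using v \<psi> by (simp add: harmonic_field_def solenoidal_def)
    then show "(LINT y|lborel. p y * f 1 y + q y * f 2 y) = 0"
      by (subst transfer[of p q "grad \<psi>"]) (auto simp: pq0 grad_def partial_deriv_eq[OF d])
    have "(LINT y|lebesgue_on \<Omega>. perp_grad \<psi> y \<bullet> v y) = 0"
      using v \<psi> by (simp add: harmonic_field_def irrotational_def)
    then show "(LINT y|lborel. q y * f 1 y - p y * f 2 y) = 0"
      using transfer[of q "\<lambda>y. - p y" "perp_grad \<psi>"]
      by (simp add: pq0 perp_grad_def partial_deriv_eq[OF d])
  qed
  have "weakly_dbar_closed K F"
    unfolding weakly_dbar_closed_def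
  proof (intro allI impI)
    fix \<phi> p q :: "real^2 \<Rightarrow> complex"
    assume d: "\<forall>y. (\<phi> has_derivative (\<lambda>h. h $ 1 *\<^sub>R p y + h $ 2 *\<^sub>R q y)) (at y)"
      and c: "continuous_on UNIV p" "continuous_on UNIV q" and supp: "\<forall>y. y \<notin> K \<longrightarrow> \<phi> y = 0"
    have dRe: "((\<lambda>y. Re (\<phi> y)) has_derivative (\<lambda>h. h$1 *\<^sub>R Re (p y) + h$2 *\<^sub>R Re (q y))) (at y)" for y
      using has_derivative_Re[OF d[rule_format, of y]] by simp
    have dIm: "((\<lambda>y. Im (\<phi> y)) has_derivative (\<lambda>h. h$1 *\<^sub>R Im (p y) + h$2 *\<^sub>R Im (q y))) (at y)" for y
      using has_derivative_Im[OF d[rule_format, of y]] by simp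
    have sRe: "\<forall>y. y \<notin> K \<longrightarrow> Re (\<phi> y) = 0" and sIm: "\<forall>y. y \<notin> K \<longrightarrow> Im (\<phi> y) = 0"
      using supp by simp_all
    note A = test[OF dRe continuous_on_Re[OF c(1)] continuous_on_Re[OF c(2)] sRe]
    note B = test[OF dIm continuous_on_Im[OF c(1)] continuous_on_Im[OF c(2)] sIm]
    let ?SA = "\<lambda>y. Re (p y) * f 1 y + Re (q y) * f 2 y" and ?TA = "\<lambda>y. Re (q y) * f 1 y - Re (p y) * f 2 y"
    let ?SB = "\<lambda>y. Im (p y) * f 1 y + Im (q y) * f 2 y" and ?TB = "\<lambda>y. Im (q y) * f 1 y - Im (p y) * f 2 y"
    have "F y * (p y + \<i> * q y) = of_real (?SA y - ?TB y) + \<i> * of_real (?TA y + ?SB y)" for y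
      by (simp add: F_def complex_eq_iff algebra_simps)
    then have "(LINT y|lborel. F y * (p y + \<i> * q y)) =
        (LINT y|lborel. of_real (?SA y - ?TB y) + \<i> * of_real (?TA y + ?SB y))"
      by (simp only:)
    also have "\<dots> = of_real (LINT y|lborel. ?SA y - ?TB y) + \<i> * of_real (LINT y|lborel. ?TA y + ?SB y)"
    proof -
      have "integrable lborel (\<lambda>y. ?SA y - ?TB y)" "integrable lborel (\<lambda>y. ?TA y + ?SB y)"
        by (rule Bochner_Integration.integrable_diff[OF A(1) B(3)]
            Bochner_Integration.integrable_add[OF A(3) B(1)])+
      then show ?thesis
        by (subst Bochner_Integration.integral_add)
          (simp_all only: integral_complex_of_real integral_mult_right_zero
            integrable_of_real integrable_mult_right)
    qed
    also have "(LINT y|lborel. ?SA y - ?TB y) = 0"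
      using Bochner_Integration.integral_diff[OF A(1) B(3)] A(2) B(4) by simp
    also have "(LINT y|lborel. ?TA y + ?SB y) = 0"
      using Bochner_Integration.integral_add[OF A(3) B(1)] A(4) B(2) by simp
    finally show "(LINT y|lborel. F y * (p y + \<i> * q y)) = 0" by simp
  qed
  with F FK show ?thesis by blast
qed

section \<open>Smoothness and gluing\<close>

lemma Ck_on_cong:
  assumes "open S" "\<And>x. x \<in> S \<Longrightarrow> f x = g x"
  shows "Ck_on k S f \<longleftrightarrow> Ck_on k S g"
  using assms(2)
proof (induction k arbitrary: f g)
  case 0
  then show ?case by (auto cong: continuous_on_cong)
next
  case (Suc k)
  have der: "(f has_derivative D) (at x) \<longleftrightarrow> (g has_derivative D) (at x)" if "x \<in> S" for x D
  proof
    assume "(f has_derivative D) (at x)"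
    then show "(g has_derivative D) (at x)"
      by (rule has_derivative_transform_within_open[OF _ assms(1) that Suc.prems])
  next
    assume "(g has_derivative D) (at x)"
    then show "(f has_derivative D) (at x)"
      by (rule has_derivative_transform_within_open[OF _ assms(1) that Suc.prems[symmetric]])
  qed
  then have "partial_deriv j f x = partial_deriv j g x" if "x \<in> S" for x j
    using that by (simp add: partial_deriv_def frechet_derivative_def)
  with Suc.IH have "Ck_on k S (partial_deriv j f) \<longleftrightarrow> Ck_on k S (partial_deriv j g)" for j
    by blast
  then show ?case using der by (auto simp: differentiable_def)
qed

text \<open>
  Partial derivatives of \<open>g\<close> are complex multiples of the holomorphic function \<open>deriv g\<close>, so the class of
  functions in question is closed under taking partial derivatives.
\<close>

lemma Ck_on_holomorphic:
  assumes S: "open S" and T: "open T" "cplx ` S \<subseteq> T" and L: "bounded_linear L"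
    and g: "g holomorphic_on T"
  shows "Ck_on k S (\<lambda>x. L (g (cplx x)))"
  using g
proof (induction k arbitrary: g)
  case 0
  have "continuous_on (cplx ` S) g"
    using holomorphic_on_imp_continuous_on[OF 0] T(2) by (rule continuous_on_subset)
  then have "continuous_on S (\<lambda>x. g (cplx x))"
    by (rule continuous_on_compose2) (auto intro!: continuous_intros)
  then show ?case by (simp add: bounded_linear.continuous_on[OF L])
next
  case (Suc k)
  have der: "((\<lambda>x. L (g (cplx x))) has_derivative (\<lambda>h. L (deriv g (cplx x) * cplx h))) (at x)"
    if "x \<in> S" for x
  proof -
    have "(g has_field_derivative deriv g (cplx x)) (at (cplx x))"
      using Suc.prems T that by (intro holomorphic_derivI) auto
    then have "(g has_derivative (*) (deriv g (cplx x))) (at (cplx x))"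
      by (simp add: has_field_derivative_def)
    from has_derivative_compose[OF bounded_linear_imp_has_derivative[OF bounded_linear_cplx] this]
    show ?thesis by (rule bounded_linear.has_derivative[OF L])
  qed
  have "Ck_on k S (partial_deriv j (\<lambda>x. L (g (cplx x))))" for j
  proof -
    have "(\<lambda>z. deriv g z * cplx (axis j 1)) holomorphic_on T"
      using Suc.prems T by (intro holomorphic_intros holomorphic_deriv)
    from Suc.IH[OF this]
    have "Ck_on k S (\<lambda>x. L (deriv g (cplx x) * cplx (axis j 1)))" .
    moreover have "partial_deriv j (\<lambda>x. L (g (cplx x))) x = L (deriv g (cplx x) * cplx (axis j 1))"
      if "x \<in> S" for x
      using frechet_derivative_at[OF der[OF that], symmetric] by (simp add: partial_deriv_def)
    ultimately show ?thesis by (subst Ck_on_cong[OF S]) auto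
  qed
  then show ?case using der by (auto simp: differentiable_def)
qed

text \<open>
  The set on which two continuous functions differ is open, hence empty when it is a null set.
\<close>

lemma continuous_eq_if_AE_eq:
  fixes f g :: "real^2 \<Rightarrow> complex"
  assumes U: "open U" and c: "continuous_on U f" "continuous_on U g"
    and ae: "AE y in lborel. y \<in> U \<longrightarrow> f y = g y" and x: "x \<in> U"
  shows "f x = g x"
proof (rule ccontr)
  assume "f x \<noteq> g x"
  define V where "V = {y \<in> U. f y \<noteq> g y}"
  have "V = U \<inter> (\<lambda>y. f y - g y) -` (- {0})" by (auto simp: V_def)
  then have "open V"
    using U c by (auto intro!: continuous_open_preimage continuous_intros)
  have "AE y \<in> V in lebesgue. y \<in> {}"
    using ae by (intro AE_completion) (auto elim!: eventually_mono simp: V_def)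
  then have "x \<in> {}"
    by (rule mem_closed_if_AE_lebesgue_open[OF \<open>open V\<close> closed_empty])
      (use x \<open>f x \<noteq> g x\<close> in \<open>simp add: V_def\<close>)
  then show False by simp
qed

lemma negligible_if_AE_notin:
  fixes A :: "'a::euclidean_space set"
  assumes "AE y in lborel. y \<notin> A"
  shows "negligible A"
proof -
  obtain N where N: "{y \<in> space lborel. \<not> y \<notin> A} \<subseteq> N" "emeasure lborel N = 0" "N \<in> sets lborel"
    using assms by (rule AE_E)
  then have "A \<subseteq> N" "N \<in> null_sets lebesgue"
    by (auto intro: null_sets_completionI null_setsI)
  then show ?thesis
    by (metis negligible_iff_null_sets negligible_subset)
qed

theorem corollary4p3:
  fixes \<Omega> :: "(real^2) set" and v :: "real^2 \<Rightarrow> real^2" and p :: real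
  assumes "region \<Omega>" and "bounded \<Omega>" and "Lipschitz_loop_boundary \<Omega>"
    and "1 \<le> p"
    and "v \<in> Lp_field p \<Omega>"
    and "harmonic_field \<Omega> v"
  shows "\<exists>w. smooth_on \<Omega> w \<and> (AE x in lebesgue_on \<Omega>. v x = w x)"
proof -
  have \<Omega>: "open \<Omega>" using assms(1) by (simp add: region_def)
  \<comment> \<open>Note that \<open>v\<^sub>1 - \<i> v\<^sub>2\<close> is the complex conjugate of \<open>cplx v\<close>.\<close>
  define rep where "rep a r g \<longleftrightarrow> 0 < r \<and> ball a r \<subseteq> \<Omega> \<and> g holomorphic_on ball (cplx a) r \<and>
      (AE y in lborel. y \<in> ball a r \<longrightarrow> cnj (cplx (v y)) = g (cplx y))" for a r g
  have "\<exists>r g. rep a r g" if a: "a \<in> \<Omega>" for a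
  proof -
    obtain R where R: "0 < R" "cball a R \<subseteq> \<Omega>"
      using \<Omega> a open_contains_cball by blast
    obtain F where F: "integrable lborel F" "weakly_dbar_closed (cball a R) F"
      "AE y in lborel. y \<in> cball a R \<longrightarrow> F y = cnj (cplx (v y))"
      using harmonic_field_weakly_dbar_closed[OF \<Omega> assms(6) compact_cball R(2)] by blast
    obtain g where g: "g holomorphic_on ball (cplx a) (R / 4)"
      "AE y in lborel. y \<in> ball a (R / 4) \<longrightarrow> F y = g (cplx y)"
      using weyl_dbar_local[of F a "R / 2"] F R by auto
    have "AE y in lborel. y \<in> ball a (R / 4) \<longrightarrow> cnj (cplx (v y)) = g (cplx y)"
      using F(3) g(2) by eventually_elim (use R in auto)
    moreover have "ball a (R / 4) \<subseteq> \<Omega>"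
      using R by (auto simp: subset_eq)
    ultimately have "rep a (R / 4) g" using g(1) R(1) by (simp add: rep_def)
    then show ?thesis by blast
  qed
  then obtain r g where "\<And>a. a \<in> \<Omega> \<Longrightarrow> rep a (r a) (g a)" by metis
  then have r: "\<And>a. a \<in> \<Omega> \<Longrightarrow> 0 < r a" "\<And>a. a \<in> \<Omega> \<Longrightarrow> ball a (r a) \<subseteq> \<Omega>"
    and hol: "\<And>a. a \<in> \<Omega> \<Longrightarrow> g a holomorphic_on ball (cplx a) (r a)"
    and ae: "\<And>a. a \<in> \<Omega> \<Longrightarrow> AE y in lborel. y \<in> ball a (r a) \<longrightarrow> cnj (cplx (v y)) = g a (cplx y)"
    by (simp_all add: rep_def)
  have cont: "continuous_on (ball a (r a)) (\<lambda>y. g a (cplx y))" if "a \<in> \<Omega>" for a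
    by (rule continuous_on_compose2[OF holomorphic_on_imp_continuous_on[OF hol[OF that]]])
      (auto intro!: continuous_intros)
  \<comment> \<open>At each point \<open>G\<close> uses the representative centred there; it agrees with all others nearby.\<close>
  define G where "G z = g (uncplx z) z" for z
  have G: "G (cplx x) = g a (cplx x)" if "a \<in> \<Omega>" "x \<in> ball a (r a)" for a x
  proof -
    have x: "x \<in> \<Omega>" using r(2) that by blast
    have "g x (cplx x) = g a (cplx x)"
    proof (rule continuous_eq_if_AE_eq[where f="\<lambda>y. g x (cplx y)" and g="\<lambda>y. g a (cplx y)"])
      show "open (ball x (r x) \<inter> ball a (r a))" by auto
      show "AE y in lborel. y \<in> ball x (r x) \<inter> ball a (r a) \<longrightarrow> g x (cplx y) = g a (cplx y)"
        using ae[OF x] ae[OF that(1)] by eventually_elim auto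
      show "continuous_on (ball x (r x) \<inter> ball a (r a)) (\<lambda>y. g x (cplx y))"
        by (rule continuous_on_subset[OF cont[OF x]]) simp
      show "continuous_on (ball x (r x) \<inter> ball a (r a)) (\<lambda>y. g a (cplx y))"
        by (rule continuous_on_subset[OF cont[OF that(1)]]) simp
      show "x \<in> ball x (r x) \<inter> ball a (r a)"
        using that(2) r(1)[OF x] by simp
    qed
    then show ?thesis by (simp add: G_def)
  qed
  define T where "T = (\<Union>a\<in>\<Omega>. ball (cplx a) (r a))"
  have "G holomorphic_on T"
    unfolding T_def
  proof (rule holomorphic_on_UN_open)
    fix a assume a: "a \<in> \<Omega>"
    have "G z = g a z" if "z \<in> ball (cplx a) (r a)" for z
      using G[OF a, of "uncplx z"] that dist_cplx[of a "uncplx z"] by simp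
    then show "G holomorphic_on ball (cplx a) (r a)"
      using hol[OF a] by (subst holomorphic_cong[OF refl]) auto
  qed auto
  moreover have "open T" "cplx ` \<Omega> \<subseteq> T"
    using r(1) by (auto simp: T_def)
  moreover have "bounded_linear (\<lambda>z. uncplx (cnj z))"
    by (rule bounded_linear_compose[OF bounded_linear_uncplx bounded_linear_cnj])
  ultimately have "Ck_on k \<Omega> (\<lambda>x. uncplx (cnj (G (cplx x))))" for k
    using Ck_on_holomorphic[where L="\<lambda>z. uncplx (cnj z)" and g=G, OF \<Omega>] by simp
  then have "smooth_on \<Omega> (\<lambda>x. uncplx (cnj (G (cplx x))))"
    by (simp add: smooth_on_def)
  moreover have "AE x in lebesgue_on \<Omega>. v x = uncplx (cnj (G (cplx x)))"
  proof -
    let ?N = "{x \<in> \<Omega>. v x \<noteq> uncplx (cnj (G (cplx x)))}"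
    have "negligible ?N"
    proof (rule locally_negligible_alt[THEN iffD2], rule)
      fix a assume "a \<in> ?N"
      then have a: "a \<in> \<Omega>" by simp
      have "AE y in lborel. y \<notin> ?N \<inter> ball a (r a)"
        using ae[OF a]
      proof eventually_elim
        case (elim y)
        have "v y = uncplx (cnj (G (cplx y)))" if y: "y \<in> ball a (r a)"
        proof -
          have "cnj (cplx (v y)) = G (cplx y)" using elim y G[OF a y] by simp
          then have "uncplx (cnj (G (cplx y))) = uncplx (cplx (v y))"
            by (metis complex_cnj_cnj)
          then show ?thesis by simp
        qed
        then show ?case by blast
      qed
      then have "negligible (?N \<inter> ball a (r a))"
        by (rule negligible_if_AE_notin)
      moreover have "openin (top_of_set ?N) (?N \<inter> ball a (r a))" by (rule openin_open_Int) simp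
      ultimately show "\<exists>U. openin (top_of_set ?N) U \<and> a \<in> U \<and> negligible U"
        using \<open>a \<in> ?N\<close> centre_in_ball[of a "r a"] r(1)[OF a] by blast
    qed
    then have "AE x in lebesgue. x \<notin> ?N"
      by (intro AE_not_in) (simp add: negligible_iff_null_sets)
    then have "AE x in lebesgue. x \<in> \<Omega> \<longrightarrow> v x = uncplx (cnj (G (cplx x)))"
      by eventually_elim simp
    moreover have "\<Omega> \<inter> space lebesgue \<in> sets lebesgue"
      using \<Omega> by simp
    ultimately show ?thesis
      using AE_restrict_space_iff by blast
  qed
  ultimately show ?thesis by blast
qed

end
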